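(* Let $n \in \mathbb{N}$, $n\ge 1$, and let $F$ be a finite subgroup of $\mathbb{T}^n$ of order $q$. Let $\mathcal{B} = C(\mathbb{T}^n)$, let $\mathcal{A}\subseteq\mathcal{B}$ be the subalgebra of functions invariant under translation by the elements of $F$, and for $f,g\in\mathcal{B}$ let $\langle f,g\rangle_{\mathcal{A}}(x) = q^{-1}\sum_{w\in F} f(x-w)\overline{g(x-w)}$. (1) Let $m_0\in\mathcal{B}$ satisfy $m_0(0)=q$ and $\langle m_0,m_0\rangle_{\mathcal{A}} = q$ (the constant function). Suppose that either $q=2$ or $n<2q-1$. Then there exist $m_1,\dots,m_{q-1}\in\mathcal{B}$ such that $\langle m_j,m_k\rangle_{\mathcal{A}} = q\,\delta_{jk}$ for all $0\le j,k\le q-1$. In particular, if $n\le 4$, then for any $q$ every $m_0\in\mathcal{B}$ with $m_0(0)=q$ and $\langle m_0,m_0\rangle_{\mathcal{A}}=q$ admits such a family $m_1,\dots,m_{q-1}\in\mathcal{B}$. (2) Let $n$ and $q$ be arbitrary. Let $m_0\in\mathcal{B}$ satisfy $m_0(0)=q$ and $\langle m_0,m_0\rangle_{\mathcal{A}} = q$, and suppose there exist $m_1,\dots,m_{q-1}\in\mathcal{B}$ with $\langle m_j,m_k\rangle_{\mathcal{A}} = q\,\delta_{jk}$ for all $0\le j,k\le q-1$. If $m_0$ is infinitely differentiable, then there exist infinitely differentiable functions $m_1',\dots,m_{q-1}'$ on $\mathbb{T}^n$ such that, setting $m_0'=m_0$, one has $\langle m_j',m_k'\rangle_{\mathcal{A}}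 = q\,\delta_{jk}$ for all $0\le j,k\le q-1$.
   Context: $\mathbb{T}^n=\mathbb{R}^n/\mathbb{Z}^n$, written additively, and $C(\mathbb{T}^n)$ is the algebra of continuous complex-valued functions on $\mathbb{T}^n$. The function $\langle f,g\rangle_{\mathcal{A}}$ lies in $\mathcal{A}$. A function $m_0\in C(\mathbb{T}^n)$ with $m_0(0)=q$ and $\langle m_0,m_0\rangle_{\mathcal{A}}=q$ is called a (continuous) low-pass filter, and a family $m_1,\dots,m_{q-1}\in C(\mathbb{T}^n)$ with $\langle m_j,m_k\rangle_{\mathcal{A}}=q\delta_{jk}$ for $0\le j,k\le q-1$ is called a (continuous) high-pass filter family corresponding to $m_0$. *)

theory Defs
  imports "HOL-Analysis.Analysis"
begin

text \<open>The torus \<open>\<real>\<^sup>n / \<int>\<^sup>n\<close> with \<open>n = CARD('n)\<close>, with the quotient group structure and the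
  quotient topology.\<close>

quotient_type (overloaded) 'n torus = "real ^ ('n::finite)" /
  "\<lambda>x y. \<forall>i. x $ i - y $ i \<in> \<int>"
proof (rule equivpI)
  show "reflp (\<lambda>x y :: real ^ 'n. \<forall>i. x $ i - y $ i \<in> \<int>)"
    by (simp add: reflp_def)
  show "symp (\<lambda>x y :: real ^ 'n. \<forall>i. x $ i - y $ i \<in> \<int>)"
  proof (rule sympI, rule allI)
    fix x y :: "real ^ 'n" and i
    assume "\<forall>i. x $ i - y $ i \<in> \<int>"
    then have "- (x $ i - y $ i) \<in> \<int>" by (intro Ints_minus) auto
    then show "y $ i - x $ i \<in> \<int>" by simp
  qed
  show "transp (\<lambda>x y :: real ^ 'n. \<forall>i. x $ i - y $ i \<in> \<int>)"
  proof (rule transpI)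
    fix x y z :: "real ^ 'n"
    assume xy: "\<forall>i. x $ i - y $ i \<in> \<int>" and yz: "\<forall>i. y $ i - z $ i \<in> \<int>"
    show "\<forall>i. x $ i - z $ i \<in> \<int>"
    proof
      fix i
      have "(x $ i - y $ i) + (y $ i - z $ i) \<in> \<int>"
        using xy yz by (intro Ints_add) auto
      then show "x $ i - z $ i \<in> \<int>" by simp
    qed
  qed
qed

lift_definition torus_proj :: "real ^ ('n::finite) \<Rightarrow> 'n torus" is "\<lambda>x. x" .

instantiation torus :: (finite) ab_group_add
begin

lift_definition zero_torus :: "'a torus" is 0 .

lift_definition plus_torus :: "'a torus \<Rightarrow> 'a torus \<Rightarrow> 'a torus" is "(+)"
proof -
  fix x x' y y' :: "real ^ 'a" and i
  assume "\<And>i. x $ i - x' $ i \<in> \<int>" and "\<And>i. y $ i - y' $ i \<in> \<int>"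
  then have "(x $ i - x' $ i) + (y $ i - y' $ i) \<in> \<int>" by (rule Ints_add)
  then show "(x + y) $ i - (x' + y') $ i \<in> \<int>" by (simp add: algebra_simps)
qed

lift_definition uminus_torus :: "'a torus \<Rightarrow> 'a torus" is "uminus"
proof -
  fix x x' :: "real ^ 'a" and i
  assume "\<And>i. x $ i - x' $ i \<in> \<int>"
  then have "- (x $ i - x' $ i) \<in> \<int>" by (rule Ints_minus)
  then show "(- x) $ i - (- x') $ i \<in> \<int>" by simp
qed

definition minus_torus :: "'a torus \<Rightarrow> 'a torus \<Rightarrow> 'a torus"
  where "minus_torus x y = x + (- y)"

instance
proof
  fix a b c :: "'a torus"
  show "a + b + c = a + (b + c)" by transfer (simp add: add.assoc)
  show "a + b = b + a" by transfer (simp add: add.commute)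
  show "0 + a = a" by transfer simp
  show "- a + a = 0" by transfer simp
  show "a - b = a + - b" by (simp add: minus_torus_def)
qed

end

lemma torus_proj_plus: "torus_proj (x + y) = torus_proj x + torus_proj y"
  by transfer simp

lemma torus_proj_surj: "\<exists>x. torus_proj x = a"
  by transfer (metis Ints_0 diff_self)

instantiation torus :: (finite) topological_space
begin

definition open_torus :: "'a torus set \<Rightarrow> bool"
  where "open_torus U \<longleftrightarrow> open (torus_proj -` U)"

instance
  by standard (simp_all add: open_torus_def vimage_Union open_Int open_UN)

end

lemma continuous_on_torus_iff:
  fixes f :: "('n::finite) torus \<Rightarrow> 'b::topological_space"
  shows "continuous_on UNIV f \<longleftrightarrow> continuous_on UNIV (f \<circ> torus_proj)"
  by (simp add: continuous_on_open_vimage open_torus_def vimage_comp o_def)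

lemma continuous_on_torus_diff:
  fixes w :: "('n::finite) torus"
  shows "continuous_on UNIV (\<lambda>x. x - w)"
proof -
  obtain v where v: "torus_proj v = - w" using torus_proj_surj by blast
  have "(\<lambda>x. x - w) \<circ> torus_proj = torus_proj \<circ> (\<lambda>x. x + v)"
    by (simp add: fun_eq_iff torus_proj_plus v)
  moreover have "continuous_on UNIV (torus_proj :: real ^ 'n \<Rightarrow> _)"
    by (simp add: continuous_on_open_vimage open_torus_def)
  then have "continuous_on UNIV (torus_proj \<circ> (\<lambda>x. x + v))"
    by (intro continuous_on_compose continuous_intros) (auto intro: continuous_on_subset)
  ultimately show ?thesis by (simp add: continuous_on_torus_iff)
qed

definition torus_subgroup :: "('n::finite) torus set \<Rightarrow> bool"
  where "torus_subgroup F \<longleftrightarrow>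
    0 \<in> F \<and> (\<forall>x\<in>F. \<forall>y\<in>F. x + y \<in> F) \<and> (\<forall>x\<in>F. - x \<in> F)"

definition torus_C :: "(('n::finite) torus \<Rightarrow> complex) set"
  where "torus_C = {f. continuous_on UNIV f}"

definition torus_C_inv :: "('n::finite) torus set \<Rightarrow> ('n torus \<Rightarrow> complex) set"
  where "torus_C_inv F = {f \<in> torus_C. \<forall>w\<in>F. \<forall>x. f (x - w) = f x}"

definition ip_A :: "('n::finite) torus set \<Rightarrow> ('n torus \<Rightarrow> complex) \<Rightarrow> ('n torus \<Rightarrow> complex)
    \<Rightarrow> 'n torus \<Rightarrow> complex"
  where "ip_A F f g = (\<lambda>x. inverse (of_nat (card F)) * (\<Sum>w\<in>F. f (x - w) * cnj (g (x - w))))"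

lemma ip_A_in_torus_C_inv:
  fixes F :: "('n::finite) torus set"
  assumes F: "torus_subgroup F" and f: "f \<in> torus_C" and g: "g \<in> torus_C"
  shows "ip_A F f g \<in> torus_C_inv F"
proof -
  have tr: "continuous_on UNIV (\<lambda>x. h (x - w))" if "h \<in> torus_C"
    for h :: "'n torus \<Rightarrow> complex" and w
    using continuous_on_compose2[of UNIV h UNIV "\<lambda>x. x - w"] that continuous_on_torus_diff
    by (auto simp: torus_C_def)
  have "continuous_on UNIV (ip_A F f g)"
    unfolding ip_A_def by (intro continuous_intros tr f g)
  moreover have "ip_A F f g (x - v) = ip_A F f g x" if v: "v \<in> F" for v x
  proof -
    have "(\<Sum>w\<in>F. f (x - v - w) * cnj (g (x - v - w))) = (\<Sum>w\<in>F. f (x - w) * cnj (g (x - w)))"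
    proof (rule sum.reindex_bij_witness[where i = "\<lambda>w. w + (- v)" and j = "\<lambda>w. w + v"])
      fix w assume w: "w \<in> F"
      show "w + v \<in> F" "w + (- v) \<in> F"
        using F v w unfolding torus_subgroup_def by blast+
    qed (simp_all add: algebra_simps)
    then show ?thesis by (simp add: ip_A_def)
  qed
  ultimately show ?thesis by (simp add: torus_C_inv_def torus_C_def)
qed

primrec k_times_diff :: "nat \<Rightarrow> ('a::real_normed_vector \<Rightarrow> 'b::real_normed_vector) \<Rightarrow> bool"
  where
    "k_times_diff 0 f \<longleftrightarrow> continuous_on UNIV f"
  | "k_times_diff (Suc k) f \<longleftrightarrow> (\<forall>x. f differentiable (at x)) \<and>
       (\<forall>v. k_times_diff k (\<lambda>x. frechet_derivative f (at x) v))"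

text \<open>Smoothness on the torus is smoothness of the periodic lift to \<open>\<real>\<^sup>n\<close>, the projection being
  a local diffeomorphism. Derivatives are real, also for complex-valued functions.\<close>

definition torus_smooth :: "(('n::finite) torus \<Rightarrow> complex) \<Rightarrow> bool"
  where "torus_smooth f \<longleftrightarrow> (\<forall>k. k_times_diff k (f \<circ> torus_proj))"

definition low_pass_filter :: "('n::finite) torus set \<Rightarrow> ('n torus \<Rightarrow> complex) \<Rightarrow> bool"
  where "low_pass_filter F m0 \<longleftrightarrow> m0 \<in> torus_C \<and> m0 0 = of_nat (card F) \<and>
    ip_A F m0 m0 = (\<lambda>_. of_nat (card F))"

text \<open>Only the values \<open>m 1, \<dots>, m (q - 1)\<close> matter, where \<open>q = card F\<close>; the slot \<open>0\<close> of the
  family is filled with \<open>m0\<close>.\<close>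

definition high_pass_family ::
    "('n::finite) torus set \<Rightarrow> ('n torus \<Rightarrow> complex) \<Rightarrow> (nat \<Rightarrow> 'n torus \<Rightarrow> complex) \<Rightarrow> bool"
  where "high_pass_family F m0 m \<longleftrightarrow>
    (\<forall>j\<in>{1..<card F}. m j \<in> torus_C) \<and>
    (\<forall>j\<in>{0..<card F}. \<forall>k\<in>{0..<card F}.
      ip_A F ((m(0 := m0)) j) ((m(0 := m0)) k) = (\<lambda>_. if j = k then of_nat (card F) else 0))"

end

theory Submission
  imports Defs
begin

text \<open>
  The algebra \<open>\<B> = C(\<T>\<^sup>n)\<close> is a free module over \<open>\<A>\<close> with an orthonormal frame of \<open>q\<close> characters,
  and a high-pass family for \<open>m\<^sub>0\<close> is an orthonormal frame starting with \<open>m\<^sub>0 / \<surd>q\<close>. An orthonormal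
  frame containing \<open>g\<close> can be reflected to one with \<open>h\<close> in place of \<open>g\<close>, for any unit vector \<open>h\<close> that
  differs from \<open>g\<close> at every point; the other vectors orthogonal to \<open>h\<close> do not move. For \<open>n < 2q - 1\<close>
  let \<open>u\<close> be a normalized smooth approximation of \<open>- m\<^sub>0\<close>. In coordinates, \<open>u\<close> is a smooth map from an
  \<open>n\<close>-dimensional torus to the sphere of dimension \<open>2q - 1\<close>, so it misses a point \<open>p\<close>, and the frame of
  characters can be reflected to \<open>p\<close>, then to \<open>u\<close> and then to \<open>m\<^sub>0 / \<surd>q\<close>. For \<open>q = 2\<close> the orthogonal
  complement is given by an explicit formula. For part (2), the vectors of a continuous frame are
  reflected one at a time to smooth ones.
\<close>

subsection \<open>Smooth functions on the torus\<close>

text \<open>Derivatives are unique, so an explicit derivative \<open>D\<close> may stand in for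
  \<open>frechet_derivative\<close>. Together with the elimination rule below, this lets closure
  properties be proved by induction on \<open>k\<close> with the usual derivative rules.\<close>

lemma k_times_diff_SucI:
  assumes "\<And>x. (f has_derivative D x) (at x)" and "\<And>v. k_times_diff k (\<lambda>x. D x v)"
  shows "k_times_diff (Suc k) f"
proof -
  have "frechet_derivative f (at x) = D x" for x
    using frechet_derivative_at[OF assms(1)[of x]] by simp
  then show ?thesis
    using assms by (auto simp: differentiable_def)
qed

lemma k_times_diff_SucE:
  assumes "k_times_diff (Suc k) f"
  obtains D where "\<And>x. (f has_derivative D x) (at x)" and "\<And>v. k_times_diff k (\<lambda>x. D x v)"
proof
  show "(f has_derivative frechet_derivative f (at x)) (at x)" for x
    using assms by (simp add: frechet_derivative_works)
  show "k_times_diff k (\<lambda>x. frechet_derivative f (at x) v)" for v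
    using assms by simp
qed

text \<open>The product rule keeps undifferentiated factors, so inductions over products need the
  functions themselves at the lower order \<open>k\<close>.\<close>

lemma k_times_diff_SucD: "k_times_diff (Suc k) f \<Longrightarrow> k_times_diff k f"
proof (induction k arbitrary: f)
  case 0
  then have "isCont f x" for x
    by (intro differentiable_imp_continuous_within) simp
  then show ?case
    by (simp add: continuous_at_imp_continuous_on)
next
  case (Suc k)
  from Suc.prems obtain D where D: "\<And>x. (f has_derivative D x) (at x)"
      "\<And>v. k_times_diff (Suc k) (\<lambda>x. D x v)"
    by (rule k_times_diff_SucE) blast
  show ?case
    by (rule k_times_diff_SucI[OF D(1)]) (rule Suc.IH[OF D(2)])
qed

lemma k_times_diff_const: "k_times_diff k (\<lambda>x. c)"
proof (induction k arbitrary: c)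
  case (Suc k)
  show ?case by (rule k_times_diff_SucI[where D = "\<lambda>x v. 0"]) (auto simp: Suc)
qed simp

lemma k_times_diff_add:
  "k_times_diff k f \<Longrightarrow> k_times_diff k g \<Longrightarrow> k_times_diff k (\<lambda>x. f x + g x)"
proof (induction k arbitrary: f g)
  case 0
  then show ?case by (auto intro: continuous_intros)
next
  case (Suc k)
  from Suc.prems(1) obtain D where D: "\<And>x. (f has_derivative D x) (at x)"
      "\<And>v. k_times_diff k (\<lambda>x. D x v)"
    by (rule k_times_diff_SucE) blast
  from Suc.prems(2) obtain E where E: "\<And>x. (g has_derivative E x) (at x)"
      "\<And>v. k_times_diff k (\<lambda>x. E x v)"
    by (rule k_times_diff_SucE) blast
  show ?case
    by (rule k_times_diff_SucI[OF has_derivative_add[OF D(1) E(1)]]) (rule Suc.IH[OF D(2) E(2)])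
qed

lemma k_times_diff_bounded_linear:
  assumes L: "bounded_linear L"
  shows "k_times_diff k f \<Longrightarrow> k_times_diff k (\<lambda>x. L (f x))"
proof (induction k arbitrary: f)
  case 0
  then show ?case using L by (auto intro: bounded_linear.continuous_on)
next
  case (Suc k)
  from Suc.prems obtain D where D: "\<And>x. (f has_derivative D x) (at x)"
      "\<And>v. k_times_diff k (\<lambda>x. D x v)"
    by (rule k_times_diff_SucE) blast
  show ?case
    by (rule k_times_diff_SucI[OF bounded_linear.has_derivative[OF L D(1)]]) (rule Suc.IH[OF D(2)])
qed

lemma k_times_diff_mult:
  fixes f g :: "'a::real_normed_vector \<Rightarrow> 'b::real_normed_algebra"
  shows "k_times_diff k f \<Longrightarrow> k_times_diff k g \<Longrightarrow> k_times_diff k (\<lambda>x. f x * g x)"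
proof (induction k arbitrary: f g)
  case 0
  then show ?case by (auto intro: continuous_intros)
next
  case (Suc k)
  from Suc.prems(1) obtain D where D: "\<And>x. (f has_derivative D x) (at x)"
      "\<And>v. k_times_diff k (\<lambda>x. D x v)"
    by (rule k_times_diff_SucE) blast
  from Suc.prems(2) obtain E where E: "\<And>x. (g has_derivative E x) (at x)"
      "\<And>v. k_times_diff k (\<lambda>x. E x v)"
    by (rule k_times_diff_SucE) blast
  show ?case
    by (rule k_times_diff_SucI[OF has_derivative_mult[OF D(1) E(1)]])
      (intro k_times_diff_add Suc.IH D(2) E(2) Suc.prems[THEN k_times_diff_SucD])
qed

lemma k_times_diff_shift: "k_times_diff k f \<Longrightarrow> k_times_diff k (\<lambda>x. f (x + a))"
proof (induction k arbitrary: f)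
  case 0
  have "continuous_on UNIV (\<lambda>x. x + a)"
    by (intro continuous_intros)
  then show ?case
    using 0 continuous_on_compose2[of UNIV f UNIV "\<lambda>x. x + a"] by simp
next
  case (Suc k)
  from Suc.prems obtain D where D: "\<And>x. (f has_derivative D x) (at x)"
      "\<And>v. k_times_diff k (\<lambda>x. D x v)"
    by (rule k_times_diff_SucE) blast
  have "((\<lambda>x. f (x + a)) has_derivative D (x + a)) (at x)" for x
    by (rule has_derivative_compose[where f = "\<lambda>x. x + a" and f' = "\<lambda>v. v", OF _ D(1)])
      (auto intro!: derivative_eq_intros)
  then show ?case
    by (rule k_times_diff_SucI) (rule Suc.IH[OF D(2)])
qed

text \<open>The derivative of \<open>inverse (sqrt y)\<close> is \<open>- 1/2\<close> times its own
  cube. The derivative of the composite is thus a product of \<open>D\<close> and the function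
  itself, to which the induction hypothesis applies.\<close>

lemma k_times_diff_inverse_sqrt:
  fixes f :: "'a::real_normed_vector \<Rightarrow> real"
  assumes pos: "\<And>x. f x > 0"
  shows "k_times_diff k f \<Longrightarrow> k_times_diff k (\<lambda>x. inverse (sqrt (f x)))"
proof (induction k)
  case 0
  have "\<forall>x\<in>UNIV. sqrt (f x) \<noteq> 0"
    using pos by (simp add: order_less_imp_not_eq2)
  with 0 show ?case
    by (simp add: continuous_on_inverse continuous_on_real_sqrt)
next
  case (Suc k)
  let ?g = "\<lambda>x. inverse (sqrt (f x))"
  from Suc.prems obtain D where D: "\<And>x. (f has_derivative D x) (at x)"
      "\<And>v. k_times_diff k (\<lambda>x. D x v)"
    by (rule k_times_diff_SucE) blast
  have g: "k_times_diff k ?g"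
    by (rule Suc.IH[OF k_times_diff_SucD[OF Suc.prems]])
  have "DERIV (\<lambda>y. inverse (sqrt y)) (f x) :> - (1/2) * (?g x * (?g x * ?g x))" for x
    using pos[of x] by (auto intro!: derivative_eq_intros simp: field_simps)
  from DERIV_compose_FDERIV[OF this D(1)]
  have "(?g has_derivative (\<lambda>v. D x v * (- (1/2) * (?g x * (?g x * ?g x))))) (at x)" for x .
  then show ?case
    by (rule k_times_diff_SucI) (intro k_times_diff_mult k_times_diff_const D(2) g)
qed

text \<open>Each directional derivative of \<open>cis (L x)\<close> is a constant multiple of
  \<open>cis (L x)\<close>, so the induction closes at once.\<close>

lemma k_times_diff_cis:
  fixes L :: "'a::real_normed_vector \<Rightarrow> real"
  assumes L: "bounded_linear L"
  shows "k_times_diff k (\<lambda>x. cis (L x))"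
proof (induction k)
  case 0
  then show ?case
    by (auto intro!: continuous_intros bounded_linear.continuous_on[OF L])
next
  case (Suc k)
  have "((\<lambda>x. of_real (cos (L x)) + \<i> * of_real (sin (L x))) has_derivative
      (\<lambda>v. of_real (L v) * (\<i> * cis (L x)))) (at x)" for x
    by (rule derivative_eq_intros bounded_linear_imp_has_derivative[OF L] refl ext | simp)+
      (simp add: complex_eq_iff)
  then have "((\<lambda>x. cis (L x)) has_derivative (\<lambda>v. of_real (L v) * (\<i> * cis (L x)))) (at x)" for x
    by (simp add: cis.code Complex_eq)
  then show ?case
    by (rule k_times_diff_SucI) (intro k_times_diff_mult k_times_diff_const Suc.IH)
qed

section \<open>Passage from the periodic lift to functions on the torus\<close>

lemma torus_smoothI: "(\<And>k. k_times_diff k (\<lambda>x. f (torus_proj x))) \<Longrightarrow> torus_smooth f"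
  by (simp add: torus_smooth_def o_def)

lemma torus_smoothD: "torus_smooth f \<Longrightarrow> k_times_diff k (\<lambda>x. f (torus_proj x))"
  by (simp add: torus_smooth_def o_def)

lemma torus_smooth_const: "torus_smooth (\<lambda>x. c)"
  by (rule torus_smoothI, intro k_times_diff_const)

lemma torus_smooth_add: "torus_smooth f \<Longrightarrow> torus_smooth g \<Longrightarrow> torus_smooth (\<lambda>x. f x + g x)"
  by (rule torus_smoothI, rule k_times_diff_add; rule torus_smoothD)

lemma torus_smooth_mult: "torus_smooth f \<Longrightarrow> torus_smooth g \<Longrightarrow> torus_smooth (\<lambda>x. f x * g x)"
  by (rule torus_smoothI, rule k_times_diff_mult; rule torus_smoothD)

lemma torus_smooth_bounded_linear:
  "bounded_linear L \<Longrightarrow> torus_smooth f \<Longrightarrow> torus_smooth (\<lambda>x. L (f x))"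
  by (rule torus_smoothI, rule k_times_diff_bounded_linear, assumption, rule torus_smoothD)

lemma torus_smooth_diff:
  assumes "torus_smooth f" "torus_smooth g" shows "torus_smooth (\<lambda>x. f x - g x)"
  using torus_smooth_add[OF assms(1) torus_smooth_bounded_linear[OF bounded_linear_minus[OF bounded_linear_ident] assms(2)]]
  by simp

lemma torus_smooth_sum:
  assumes "\<And>i. i \<in> I \<Longrightarrow> torus_smooth (f i)"
  shows "torus_smooth (\<lambda>x. \<Sum>i\<in>I. f i x)"
  using assms
proof (induction I rule: infinite_finite_induct)
  case (insert i I)
  then have "torus_smooth (\<lambda>x. f i x + (\<Sum>i\<in>I. f i x))"
    by (intro torus_smooth_add) simp_all
  then show ?case using insert.hyps by simp
qed (simp_all add: torus_smooth_const)

lemma torus_smooth_shift: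
  assumes "torus_smooth f" shows "torus_smooth (\<lambda>x. f (x - w))"
proof -
  obtain v where v: "torus_proj v = - w" using torus_proj_surj by blast
  have "f (torus_proj x - w) = f (torus_proj (x + v))" for x
    by (simp add: torus_proj_plus v)
  then show ?thesis
    using k_times_diff_shift[OF torus_smoothD[OF assms], of _ v] by (intro torus_smoothI) simp
qed

lemma torus_smooth_ip_A:
  assumes "torus_smooth f" "torus_smooth g" shows "torus_smooth (ip_A F f g)"
proof -
  have "torus_smooth (\<lambda>x. cnj (g (x - w)))" for w
    by (rule torus_smooth_bounded_linear[OF bounded_linear_cnj torus_smooth_shift[OF assms(2)]])
  then show ?thesis
    unfolding ip_A_def
    by (intro torus_smooth_mult[OF torus_smooth_const] torus_smooth_sum)
      (rule torus_smooth_mult[OF torus_smooth_shift[OF assms(1)]])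
qed

lemma torus_smooth_inverse_sqrt:
  assumes "torus_smooth f" "\<And>x. Re (f x) > 0"
  shows "torus_smooth (\<lambda>x. of_real (inverse (sqrt (Re (f x)))))"
proof (rule torus_smoothI)
  fix k
  have "k_times_diff k (\<lambda>x. Re (f (torus_proj x)))"
    by (rule k_times_diff_bounded_linear[OF bounded_linear_Re torus_smoothD[OF assms(1)]])
  then have "k_times_diff k (\<lambda>x. inverse (sqrt (Re (f (torus_proj x)))))"
    by (rule k_times_diff_inverse_sqrt[OF assms(2)])
  then show "k_times_diff k (\<lambda>x. complex_of_real (inverse (sqrt (Re (f (torus_proj x))))))"
    by (rule k_times_diff_bounded_linear[OF bounded_linear_of_real])
qed

lemma torus_smooth_imp_torus_C: "torus_smooth f \<Longrightarrow> f \<in> torus_C"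
  using torus_smoothD[of f 0] by (simp add: torus_C_def continuous_on_torus_iff o_def)

subsection \<open>Characters and smooth approximation\<close>

lift_definition torus_char :: "int ^ 'n \<Rightarrow> ('n::finite) torus \<Rightarrow> complex"
  is "\<lambda>k x. cis (2 * pi * (\<Sum>i\<in>UNIV. of_int (k $ i) * x $ i))"
proof -
  fix k :: "int ^ 'n" and x y :: "real ^ 'n"
  assume xy: "\<And>i. x $ i - y $ i \<in> \<int>"
  have "(\<Sum>i\<in>UNIV. of_int (k $ i) * (x $ i - y $ i)) \<in> (\<int> :: real set)"
    by (intro Ints_sum Ints_mult xy) auto
  then have "cis (2 * pi * (\<Sum>i\<in>UNIV. of_int (k $ i) * (x $ i - y $ i))) = 1"
    by (rule cis_multiple_2pi)
  then have "cis (2 * pi * (\<Sum>i\<in>UNIV. of_int (k $ i) * x $ i))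
       / cis (2 * pi * (\<Sum>i\<in>UNIV. of_int (k $ i) * y $ i)) = 1"
    by (simp add: cis_divide right_diff_distrib sum_subtractf)
  then show "cis (2 * pi * (\<Sum>i\<in>UNIV. of_int (k $ i) * x $ i))
       = cis (2 * pi * (\<Sum>i\<in>UNIV. of_int (k $ i) * y $ i))"
    by simp
qed

lemma torus_char_proj:
  "torus_char k (torus_proj x) = cis (2 * pi * (\<Sum>i\<in>UNIV. of_int (k $ i) * x $ i))"
  by transfer simp

lemma torus_char_add_right: "torus_char k (x + y) = torus_char k x * torus_char k y"
  by transfer (simp add: cis_mult distrib_left sum.distrib)

lemma torus_char_add_left: "torus_char (k + l) x = torus_char k x * torus_char l x"
  by transfer (simp add: cis_mult distrib_left distrib_right sum.distrib)

lemma torus_char_zero [simp]: "torus_char k 0 = 1" "torus_char 0 x = 1"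
  by (transfer, simp)+

lemma torus_char_minus_left: "torus_char (- k) x = cnj (torus_char k x)"
  by transfer (simp add: cis_cnj sum_negf)

lemma norm_torus_char [simp]: "cmod (torus_char k x) = 1"
  by transfer simp

lemma torus_char_nonzero [simp]: "torus_char k x \<noteq> 0"
  using norm_torus_char[of k x] by (metis norm_zero zero_neq_one)

lemma torus_smooth_char:
  fixes k :: "int ^ 'n::finite"
  shows "torus_smooth (torus_char k)"
proof (rule torus_smoothI)
  have "bounded_linear (\<lambda>x::real^'n. 2 * pi * (\<Sum>i\<in>UNIV. of_int (k $ i) * x $ i))"
    by (rule bounded_linear_const_mult, rule bounded_linear_sum, rule bounded_linear_const_mult)
      (rule bounded_linear_vec_nth)
  then show "k_times_diff m (\<lambda>x. torus_char k (torus_proj x))" for m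
    unfolding torus_char_proj by (rule k_times_diff_cis)
qed

text \<open>If coordinate \<open>i\<close> differs by a non-integer, the character with index
  \<open>axis i 1\<close> tells the points apart. This separation underlies the Hausdorff property,
  the smooth approximation and the orthogonality on \<open>F\<close>.\<close>

lemma torus_char_separates:
  assumes "x \<noteq> y" shows "\<exists>k. torus_char k x \<noteq> torus_char k y"
  using assms
proof (transfer, goal_cases)
  case (1 x y)
  then obtain i where i: "x $ i - y $ i \<notin> \<int>" by blast
  have "cis (2 * pi * (\<Sum>j\<in>UNIV. of_int (axis i 1 $ j) * x $ j)) = cis (2 * pi * x $ i)" for x :: "real^'a"
    using sum.delta[of UNIV i "\<lambda>j. x $ j"] by (simp add: axis_def of_bool_def if_distrib if_distribR cong: if_cong)
  moreover have "cis (2 * pi * x $ i) \<noteq> cis (2 * pi * y $ i)"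
  proof
    assume "cis (2 * pi * x $ i) = cis (2 * pi * y $ i)"
    then have "cis (2 * pi * (x $ i - y $ i)) = 1"
      by (simp add: right_diff_distrib flip: cis_divide)
    then have "cos (2 * pi * (x $ i - y $ i)) = 1"
      by (metis cis.sel(1) one_complex.sel(1))
    then obtain n :: int where "2 * pi * (x $ i - y $ i) = of_int n * 2 * pi"
      unfolding cos_one_2pi_int by blast
    then have "x $ i - y $ i = of_int n" by simp
    with i show False by simp
  qed
  ultimately show ?case by (intro exI[of _ "axis i 1"]) simp
qed

section \<open>Topology of the torus and smooth approximation\<close>

instance torus :: (finite) t2_space
proof
  \<comment> \<open>The locale \<open>function_ring_on\<close> of the Stone-Weierstrass theorem asks
    for a Hausdorff type. A separating character pulls back disjoint neighbourhoods of its two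
    values.\<close>
  fix x y :: "'a torus" assume "x \<noteq> y"
  then obtain k where k: "torus_char k x \<noteq> torus_char k y"
    using torus_char_separates by blast
  then obtain U V where UV: "open U" "open V" "torus_char k x \<in> U" "torus_char k y \<in> V" "U \<inter> V = {}"
    using hausdorff by meson
  have "continuous_on UNIV (torus_char k)"
    using torus_smooth_imp_torus_C[OF torus_smooth_char] by (simp add: torus_C_def)
  then have "open (torus_char k -` U)" "open (torus_char k -` V)"
    using UV by (auto simp: continuous_on_open_vimage)
  with UV show "\<exists>U V. open U \<and> open V \<and> x \<in> U \<and> y \<in> V \<and> U \<inter> V = {}"
    by (intro exI[of _ "torus_char k -` U"] exI[of _ "torus_char k -` V"]) auto
qed

text \<open>Fractional parts give every point a representative in the unit cube, so the torus is a
  continuous image of a compact set.\<close>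

lemma compact_torus: "compact (UNIV :: ('n::finite) torus set)"
proof -
  have "x \<in> torus_proj ` cbox 0 1" for x :: "'n torus"
  proof -
    obtain v where v: "torus_proj v = x" using torus_proj_surj by blast
    have "torus_proj (\<chi> i. frac (v $ i)) = torus_proj v"
      by transfer (simp add: frac_def)
    moreover have "(\<chi> i. frac (v $ i)) \<in> cbox 0 1"
      using frac_lt_1 by (auto simp: mem_box_cart intro: less_imp_le)
    ultimately show ?thesis using v by (metis image_eqI)
  qed
  then have "UNIV = torus_proj ` cbox 0 (1 :: real^'n)" by auto
  moreover have "continuous_on (cbox 0 1) (torus_proj :: real ^ 'n \<Rightarrow> _)"
    by (rule continuous_on_subset[of UNIV]) (simp_all add: continuous_on_open_vimage open_torus_def)
  ultimately show ?thesis
    using compact_continuous_image[OF _ compact_cbox] by fastforce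
qed

text \<open>Stone-Weierstrass for the ring of smooth real functions, where real and imaginary parts
  of characters separate points. The embedding into \<open>complex\<close> appears because
  \<open>torus_smooth\<close> is a predicate on complex functions.\<close>

lemma real_smooth_approximation:
  fixes f :: "('n::finite) torus \<Rightarrow> real"
  assumes "continuous_on UNIV f" "e > 0"
  obtains s where "torus_smooth (\<lambda>x. complex_of_real (s x))" "\<And>x. \<bar>f x - s x\<bar> < e"
proof -
  let ?R = "{s :: 'n torus \<Rightarrow> real. torus_smooth (\<lambda>x. complex_of_real (s x))}"
  interpret function_ring_on ?R UNIV
  proof
    show "compact (UNIV :: 'n torus set)" by (rule compact_torus)
    fix g assume "g \<in> ?R"
    then have "continuous_on UNIV (\<lambda>x. complex_of_real (g x))"
      using torus_smooth_imp_torus_C unfolding torus_C_def by blast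
    then have "continuous_on UNIV (\<lambda>x. Re (complex_of_real (g x)))"
      by (rule continuous_on_Re)
    then show "continuous_on UNIV g" by simp
  next
    fix x y :: "'n torus" assume "x \<noteq> y"
    then obtain k where "torus_char k x \<noteq> torus_char k y"
      using torus_char_separates by blast
    then have "Re (torus_char k x) \<noteq> Re (torus_char k y) \<or> Im (torus_char k x) \<noteq> Im (torus_char k y)"
      by (simp add: complex_eq_iff)
    moreover have "(\<lambda>x. Re (torus_char k x)) \<in> ?R" "(\<lambda>x. Im (torus_char k x)) \<in> ?R"
      using torus_smooth_bounded_linear[OF bounded_linear_compose[OF bounded_linear_of_real bounded_linear_Re]]
        torus_smooth_bounded_linear[OF bounded_linear_compose[OF bounded_linear_of_real bounded_linear_Im]]
        torus_smooth_char by blast+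
    ultimately show "\<exists>f\<in>?R. f x \<noteq> f y"
      by (elim disjE) (erule bexI, assumption)+
  qed (simp_all add: torus_smooth_add torus_smooth_mult torus_smooth_const)
  obtain s where "s \<in> ?R" "\<forall>x\<in>UNIV. \<bar>f x - s x\<bar> < e"
    using Stone_Weierstrass_basic[OF assms] by (rule bexE)
  then show ?thesis using that[of s] by simp
qed

lemma smooth_approximation:
  assumes "f \<in> torus_C" "e > 0"
  obtains s where "torus_smooth s" "\<And>x. cmod (s x - f x) < e"
proof -
  have "continuous_on UNIV (\<lambda>x. Re (f x))" "continuous_on UNIV (\<lambda>x. Im (f x))" "e / 2 > 0"
    using assms by (auto simp: torus_C_def intro: continuous_intros)
  then obtain s t where s: "torus_smooth (\<lambda>x. complex_of_real (s x))" "\<And>x. \<bar>Re (f x) - s x\<bar> < e / 2"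
    and t: "torus_smooth (\<lambda>x. complex_of_real (t x))" "\<And>x. \<bar>Im (f x) - t x\<bar> < e / 2"
    using real_smooth_approximation by metis
  show ?thesis
  proof
    show "torus_smooth (\<lambda>x. of_real (s x) + \<i> * of_real (t x))"
      by (intro torus_smooth_add torus_smooth_mult torus_smooth_const s t)
    show "cmod (of_real (s x) + \<i> * of_real (t x) - f x) < e" for x
      using cmod_le[of "of_real (s x) + \<i> * of_real (t x) - f x"] s(2)[of x] t(2)[of x]
        by (simp add: abs_minus_commute)
  qed
qed

text \<open>As the dimension \<open>2 q\<close> is not a type, the proof projects to \<open>n + 2\<close> of the real coordinates,
  where the image of a smooth map from \<open>\<real>\<^sup>n\<^sup>+\<^sup>1\<close> is a null set.\<close>

lemma smooth_lines_miss_vector: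
  fixes c :: "nat \<Rightarrow> ('n::finite) torus \<Rightarrow> complex"
  assumes c: "\<And>j. j < q \<Longrightarrow> torus_smooth (c j)" and dim: "CARD('n) + 2 \<le> 2 * q"
  obtains v where "\<And>t x. \<exists>j<q. v j \<noteq> of_real t * c j x"
proof -
  \<comment> \<open>A space of dimension \<open>CARD('n) + 2\<close>: its basis, numbered by
    \<open>h\<close>, selects the first \<open>d\<close> of the \<open>2 * q\<close> real
    coordinates. The parameters \<open>(t, y)\<close> only range over dimension
    \<open>CARD('n) + 1\<close>.\<close>
  let ?B = "Basis :: ((real ^ 'n) \<times> real \<times> real) set"
  define d where "d = card ?B"
  have d: "d \<le> 2 * q" using dim by (simp add: d_def)
  obtain h where h: "bij_betw h ?B {0..<d}"
    using ex_bij_betw_finite_nat[of ?B] by (auto simp: d_def)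
  define coord :: "(nat \<Rightarrow> complex) \<Rightarrow> nat \<Rightarrow> real"
    where "coord z m = (if even m then Re (z (m div 2)) else Im (z (m div 2)))" for z m
  \<comment> \<open>The range of \<open>Phi\<close> consists of the truncations to the chosen
    coordinates of all real multiples of values of \<open>c\<close>.\<close>
  define Phi where "Phi = (\<lambda>ty. \<Sum>b\<in>?B. (fst ty * coord (\<lambda>j. c j (torus_proj (snd ty))) (h b)) *\<^sub>R b)"
  have h_less: "h b < d" if "b \<in> ?B" for b
    using h that by (auto simp: bij_betw_def)
  have "(\<lambda>ty::real \<times> (real^'n). coord (\<lambda>j. c j (torus_proj (snd ty))) m) differentiable_on UNIV" if "m < d" for m
  proof -
    have "m div 2 < q" using that d by linarith
    then have "k_times_diff (Suc 0) (\<lambda>y. c (m div 2) (torus_proj y))"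
      by (intro torus_smoothD c)
    then have "k_times_diff (Suc 0) (\<lambda>y. Re (c (m div 2) (torus_proj y)))"
      "k_times_diff (Suc 0) (\<lambda>y. Im (c (m div 2) (torus_proj y)))"
      by (rule k_times_diff_bounded_linear[OF bounded_linear_Re]
          k_times_diff_bounded_linear[OF bounded_linear_Im])+
    then have "(\<lambda>y. coord (\<lambda>j. c j (torus_proj y)) m) differentiable (at y)" for y
      by (cases "even m") (simp_all add: coord_def)
    then have "((\<lambda>y. coord (\<lambda>j. c j (torus_proj y)) m) \<circ> snd) differentiable (at ty)"
      for ty :: "real \<times> (real^'n)"
      by (rule differentiable_chain_at[OF bounded_linear_imp_differentiable[OF bounded_linear_snd]])
    then show ?thesis
      by (simp add: differentiable_on_def o_def)
  qed
  then have "(\<lambda>ty. fst ty * coord (\<lambda>j. c j (torus_proj (snd ty))) (h b)) differentiable (at ty)"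
    if "b \<in> ?B" for b and ty :: "real \<times> (real^'n)"
    using h_less[OF that] unfolding differentiable_on_def
    by (intro differentiable_mult[OF bounded_linear_imp_differentiable[OF bounded_linear_fst]]) blast
  then have "Phi differentiable_on UNIV"
    unfolding Phi_def differentiable_on_def
    by (intro ballI differentiable_sum differentiable_scaleR differentiable_const finite_Basis) blast
  then have "negligible (range Phi)"
    by (rule negligible_differentiable_image_lowdim[rotated]) simp
  then have "range Phi \<noteq> UNIV" using non_negligible_UNIV by metis
  then obtain e where e: "e \<notin> range Phi" by blast
  \<comment> \<open>The coordinates of the missed vector \<open>e\<close> are packed in pairs into
    complex numbers. For \<open>m \<ge> d\<close> the value of \<open>f\<close> is unspecified; the
    contradiction compares coordinates \<open>h b < d\<close>.\<close>
  define f where "f m = e \<bullet> the_inv_into ?B h m" for m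
  have f: "f (h b) = e \<bullet> b" if "b \<in> ?B" for b
    using that h by (simp add: f_def bij_betw_def the_inv_into_f_f)
  define v where "v j = Complex (f (2 * j)) (f (2 * j + 1))" for j
  have coord_v: "coord v m = f m" for m
    by (auto simp: coord_def v_def)
  show ?thesis
  proof (rule that, rule ccontr)
    fix t x assume "\<not> (\<exists>j<q. v j \<noteq> of_real t * c j x)"
    then have v: "v j = of_real t * c j x" if "j < q" for j using that by blast
    obtain y where y: "torus_proj y = x" using torus_proj_surj by blast
    have "t * coord (\<lambda>j. c j x) (h b) = e \<bullet> b" if b: "b \<in> ?B" for b
    proof -
      have "h b div 2 < q" using h_less[OF b] d by linarith
      then have "coord v (h b) = t * coord (\<lambda>j. c j x) (h b)"
        using v by (simp add: coord_def)
      then show ?thesis using coord_v f[OF b] by simp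
    qed
    then have "Phi (t, y) = (\<Sum>b\<in>?B. (e \<bullet> b) *\<^sub>R b)"
      by (simp add: Phi_def y)
    then have "Phi (t, y) = e" by (simp add: euclidean_representation)
    with e show False by blast
  qed
qed

subsection \<open>Orthonormal frames\<close>

locale finite_torus_subgroup =
  fixes F :: "('n::finite) torus set"
  assumes finite_F: "finite F" and subgroup_F: "torus_subgroup F"
begin

section \<open>The \<open>\<A>\<close>-valued inner product\<close>

abbreviation ip where "ip \<equiv> ip_A F"

text \<open>Split off from continuity in \<open>torus_C_inv\<close>, because invariance alone allows
  a scalar to be pulled out of \<open>ip\<close>.\<close>

definition invariant :: "('n torus \<Rightarrow> complex) \<Rightarrow> bool"
  where "invariant a \<longleftrightarrow> (\<forall>w\<in>F. \<forall>x. a (x - w) = a x)"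

lemma invariantD: "invariant a \<Longrightarrow> w \<in> F \<Longrightarrow> a (x - w) = a x"
  by (simp add: invariant_def)

lemma zero_in_F: "0 \<in> F"
  using subgroup_F by (simp add: torus_subgroup_def)

lemma minus_in_F: "w \<in> F \<Longrightarrow> - w \<in> F"
  using subgroup_F by (simp add: torus_subgroup_def)

lemma add_in_F: "w \<in> F \<Longrightarrow> v \<in> F \<Longrightarrow> w + v \<in> F"
  using subgroup_F by (simp add: torus_subgroup_def)

lemma card_F_pos: "card F > 0"
  using zero_in_F finite_F by (auto simp: card_gt_0_iff)

lemma sum_F_translate:
  assumes "v \<in> F" shows "(\<Sum>w\<in>F. f (v + w)) = (\<Sum>w\<in>F. f w)"
proof (rule sum.reindex_bij_witness[where i = "\<lambda>w. - v + w" and j = "\<lambda>w. v + w"])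
  fix w assume "w \<in> F"
  then show "v + w \<in> F" "- v + w \<in> F"
    using assms add_in_F minus_in_F by blast+
qed (simp_all add: algebra_simps)

lemma invariant_ip: "invariant (ip f g)"
  unfolding invariant_def
proof (intro ballI allI)
  fix v x assume "v \<in> F"
  then have "(\<Sum>w\<in>F. f (x - (v + w)) * cnj (g (x - (v + w)))) = (\<Sum>w\<in>F. f (x - w) * cnj (g (x - w)))"
    by (rule sum_F_translate)
  then show "ip f g (x - v) = ip f g x"
    by (simp add: ip_A_def diff_diff_eq)
qed

lemma ip_cnj: "cnj (ip f g x) = ip g f x"
  by (simp add: ip_A_def mult.commute)

lemma ip_add_left: "ip (\<lambda>x. f x + g x) h x = ip f h x + ip g h x"
  by (simp add: ip_A_def distrib_left distrib_right sum.distrib)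

lemma ip_diff_left: "ip (\<lambda>x. f x - g x) h x = ip f h x - ip g h x"
  by (simp add: ip_A_def left_diff_distrib right_diff_distrib sum_subtractf)

lemma ip_sum_left: "ip (\<lambda>x. \<Sum>i\<in>I. f i x) h x = (\<Sum>i\<in>I. ip (f i) h x)"
proof -
  have "(\<Sum>w\<in>F. (\<Sum>i\<in>I. f i (x - w)) * cnj (h (x - w)))
      = (\<Sum>i\<in>I. \<Sum>w\<in>F. f i (x - w) * cnj (h (x - w)))"
    by (subst sum.swap) (simp add: sum_distrib_right)
  then show ?thesis by (simp add: ip_A_def flip: sum_distrib_left)
qed

text \<open>An invariant function is constant on the orbit of \<open>x\<close> under
  \<open>F\<close>, so its value leaves the sum.\<close>

lemma ip_scale_left:
  assumes "invariant a" shows "ip (\<lambda>x. a x * f x) h x = a x * ip f h x"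
proof -
  have "(\<Sum>w\<in>F. a (x - w) * f (x - w) * cnj (h (x - w)))
      = (\<Sum>w\<in>F. a x * (f (x - w) * cnj (h (x - w))))"
    by (rule sum.cong) (simp_all add: invariantD[OF assms])
  then show ?thesis by (simp add: ip_A_def mult.left_commute flip: sum_distrib_left)
qed

lemma ip_add_right: "ip h (\<lambda>x. f x + g x) x = ip h f x + ip h g x"
  using arg_cong[OF ip_add_left, of cnj f g h x] by (simp only: ip_cnj complex_cnj_add)

lemma ip_diff_right: "ip h (\<lambda>x. f x - g x) x = ip h f x - ip h g x"
  using arg_cong[OF ip_diff_left, of cnj f g h x] by (simp only: ip_cnj complex_cnj_diff)

lemma ip_scale_right:
  "invariant a \<Longrightarrow> ip h (\<lambda>x. a x * f x) x = cnj (a x) * ip h f x"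
  using arg_cong[OF ip_scale_left, of a cnj f h x] by (simp only: ip_cnj complex_cnj_mult)

lemma invariant_const: "invariant (\<lambda>x. c)"
  by (simp add: invariant_def)

text \<open>The mean of the squared modulus over the orbit of \<open>x\<close>; positivity and
  definiteness are read off from this form, orbit by orbit.\<close>

lemma ip_self: "ip f f x = of_real (inverse (card F) * (\<Sum>w\<in>F. (cmod (f (x - w)))\<^sup>2))"
  by (simp add: ip_A_def flip: complex_norm_square)

lemma ip_self_nonneg: "Re (ip f f x) \<ge> 0"
  by (simp add: ip_self sum_nonneg)

lemma ip_self_of_real: "ip f f x = of_real (Re (ip f f x))"
  by (simp only: ip_self Re_complex_of_real)

lemma ip_self_eq_0:
  assumes "ip f f x = 0" "w \<in> F" shows "f (x - w) = 0"
proof -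
  have "(\<Sum>w\<in>F. (cmod (f (x - w)))\<^sup>2) = 0"
    using assms(1) card_F_pos by (simp only: ip_self of_real_eq_0_iff) simp
  then have "(cmod (f (x - w)))\<^sup>2 = 0"
    using sum_nonneg_eq_0_iff[OF finite_F, of "\<lambda>w. (cmod (f (x - w)))\<^sup>2"] assms(2) by simp
  then show ?thesis by simp
qed

lemma ip_self_eq_0_left: "ip f f x = 0 \<Longrightarrow> ip f g x = 0"
  using ip_self_eq_0[of f x] unfolding ip_A_def[of F f g] by simp

lemma ip_self_less_1:
  assumes "\<And>w. cmod (f w) < 1" shows "Re (ip f f x) < 1"
proof -
  have "(\<Sum>w\<in>F. (cmod (f (x - w)))\<^sup>2) < (\<Sum>w\<in>F. 1)"
    using zero_in_F finite_F assms by (intro sum_strict_mono) (auto simp: power_less_one_iff abs_square_less_1)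
  then show ?thesis using card_F_pos by (simp add: ip_self field_simps)
qed

lemma ip_torus_C: "f \<in> torus_C \<Longrightarrow> g \<in> torus_C \<Longrightarrow> ip f g \<in> torus_C"
  using ip_A_in_torus_C_inv[OF subgroup_F] by (auto simp: torus_C_inv_def)

text \<open>The equality case of Cauchy-Schwarz: \<open>f - g\<close> has inner square
  \<open>1 - 1 - 1 + 1 = 0\<close> at \<open>x\<close>. So the condition
  \<open>ip f g x \<noteq> 1\<close> of a reflection follows for unit vectors that differ somewhere
  on the orbit of \<open>x\<close>.\<close>

lemma ip_eq_1_imp_eq:
  assumes "ip f f x = 1" "ip g g x = 1" "ip f g x = 1" "w \<in> F"
  shows "f (x - w) = g (x - w)"
proof -
  have "ip g f x = 1" using ip_cnj[of f g x] assms(3) by simp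
  then have "ip (\<lambda>x. f x - g x) (\<lambda>x. f x - g x) x = 0"
    using assms by (simp add: ip_diff_left ip_diff_right)
  from ip_self_eq_0[OF this assms(4)] show ?thesis by simp
qed

section \<open>Orthonormal frames, reflection and normalization\<close>

definition orthonormal_frame :: "(nat \<Rightarrow> 'n torus \<Rightarrow> complex) \<Rightarrow> bool"
  where "orthonormal_frame g \<longleftrightarrow> (\<forall>j<card F. g j \<in> torus_C) \<and>
    (\<forall>j<card F. \<forall>k<card F. \<forall>x. ip (g j) (g k) x = (if j = k then 1 else 0))"

text \<open>With \<open>w = h - g j\<close> and \<open>c = 1 / (1 - \<langle>g j, h\<rangle>)\<close>, the map \<open>y \<mapsto> y - \<langle>y, w\<rangle> c w\<close> is a
  unitary over \<open>\<A>\<close> that takes \<open>g j\<close> to \<open>h\<close>: it is a complex Householder reflection.\<close>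

lemma orthonormal_frame_reflect:
  assumes g: "orthonormal_frame g" and j: "j < card F" and h: "h \<in> torus_C"
    and unit: "\<And>x. ip h h x = 1" and ne: "\<And>x. ip (g j) h x \<noteq> 1"
  obtains g' where "orthonormal_frame g'" "g' j = h"
    "\<And>i. i < card F \<Longrightarrow> i \<noteq> j \<Longrightarrow> (\<And>x. ip (g i) h x = 0) \<Longrightarrow> g' i = g i"
proof
  define w where "w = (\<lambda>x. h x - g j x)"
  define c where "c = (\<lambda>x. 1 / (1 - ip (g j) h x))"
  define a where "a i = (\<lambda>x. ip (g i) w x * c x)" for i
  let ?g' = "\<lambda>i x. g i x - a i x * w x"
  have gC: "g i \<in> torus_C" if "i < card F" for i using g that by (simp add: orthonormal_frame_def)
  have gg: "ip (g i) (g k) x = (if i = k then 1 else 0)" if "i < card F" "k < card F" for i k x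
    using g that by (simp add: orthonormal_frame_def)
  have inv_a: "invariant (a i)" for i
    using invariant_ip[of "g i" w] invariant_ip[of "g j" h] by (simp add: a_def c_def invariant_def)
  have wC: "w \<in> torus_C" using h gC[OF j] by (auto simp: w_def torus_C_def intro: continuous_intros)
  have aC: "a i \<in> torus_C" if "i < card F" for i
    using ip_torus_C[OF gC[OF that] wC] ip_torus_C[OF gC[OF j] h] ne
    by (auto simp: a_def c_def torus_C_def intro!: continuous_intros)
  have w_w: "ip w w x = 2 - ip (g j) h x - cnj (ip (g j) h x)" for x
    using unit[of x] gg[OF j j, of x] by (simp add: w_def ip_diff_left ip_diff_right ip_cnj)
  \<comment> \<open>Here \<open>ip w w x\<close> is \<open>1 / c x + 1 / cnj (c x)\<close>. The
    identity cancels the correction term in the inner product of two images, which makes the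
    reflection unitary.\<close>
  have cancel: "cnj (c x) * c x * ip w w x = c x + cnj (c x)" for x
  proof -
    have "1 - ip (g j) h x \<noteq> 0" using ne[of x] by simp
    moreover from this have "1 - cnj (ip (g j) h x) \<noteq> 0"
      by (metis complex_cnj_cancel_iff complex_cnj_diff complex_cnj_one complex_cnj_zero)
    ultimately show ?thesis by (simp add: w_w c_def field_simps)
  qed
  have "ip (?g' i) (?g' k) x = (if i = k then 1 else 0)" if "i < card F" "k < card F" for i k x
  proof -
    have "ip (?g' i) (?g' k) x = ip (g i) (g k) x - a i x * ip w (g k) x
        - cnj (a k x) * ip (g i) w x + a i x * cnj (a k x) * ip w w x"
      unfolding ip_diff_left ip_diff_right ip_scale_left[OF inv_a] ip_scale_right[OF inv_a]
      by (simp add: algebra_simps)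
    also have "\<dots> = ip (g i) (g k) x
        + ip (g i) w x * ip w (g k) x * (cnj (c x) * c x * ip w w x - c x - cnj (c x))"
      by (simp add: a_def ip_cnj algebra_simps)
    finally show ?thesis using gg[OF that] cancel by simp
  qed
  moreover have "?g' i \<in> torus_C" if "i < card F" for i
    using gC[OF that] aC[OF that] wC by (auto simp: torus_C_def intro!: continuous_intros)
  ultimately show "orthonormal_frame ?g'"
    unfolding orthonormal_frame_def by simp
  \<comment> \<open>\<open>ip (g j) w x\<close> is \<open>ip (g j) h x - 1\<close>, which the factor
    \<open>c x\<close> turns into \<open>- 1\<close>; the image of \<open>g j\<close> is therefore
    \<open>g j + w\<close>, that is, \<open>h\<close>.\<close>
  have "a j x = - 1" for x
    using ne[of x] gg[OF j j, of x] by (simp add: a_def c_def w_def ip_diff_right field_simps)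
  then show "?g' j = h" by (simp add: w_def)
  fix i assume i: "i < card F" "i \<noteq> j" "\<And>x. ip (g i) h x = 0"
  have "a i x = 0" for x
    using gg[OF i(1) j] i by (simp add: a_def w_def ip_diff_right)
  then show "?g' i = g i" by simp
qed

definition inverse_norm :: "('n torus \<Rightarrow> complex) \<Rightarrow> 'n torus \<Rightarrow> complex"
  where "inverse_norm v = (\<lambda>x. of_real (inverse (sqrt (Re (ip v v x)))))"

lemma invariant_inverse_norm: "invariant (inverse_norm v)"
  using invariant_ip[of v v] by (simp add: inverse_norm_def invariant_def)

text \<open>Expanding \<open>near\<close> gives
  \<open>Re (ip v v x) + 2 * Re (ip h v x) < 0\<close>, so \<open>ip h v x\<close> has negative real
  part. Hence \<open>v\<close> can be normalized, and the positive scaling keeps the real part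
  negative, away from \<open>1\<close>.\<close>

lemma normalize_near_minus:
  assumes unit: "\<And>x. ip h h x = 1"
    and near: "\<And>x. Re (ip (\<lambda>x. v x + h x) (\<lambda>x. v x + h x) x) < 1"
  shows "Re (ip v v x) > 0"
    and "ip (\<lambda>x. inverse_norm v x * v x) (\<lambda>x. inverse_norm v x * v x) x = 1"
    and "ip h (\<lambda>x. inverse_norm v x * v x) x \<noteq> 1"
proof -
  define r where "r = inverse_norm v"
  note inv = invariant_inverse_norm[of v, folded r_def]
  have "Re (ip (\<lambda>x. v x + h x) (\<lambda>x. v x + h x) x) = Re (ip v v x) + 1 + 2 * Re (ip h v x)"
    using unit[of x] arg_cong[OF ip_cnj[of v h x], of Re] by (simp add: ip_add_left ip_add_right)
  then have neg: "Re (ip h v x) < 0" using near[of x] ip_self_nonneg[of v x] by linarith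
  have "ip v v x \<noteq> 0"
  proof
    assume "ip v v x = 0"
    then have "cnj (ip v h x) = 0" by (simp add: ip_self_eq_0_left)
    then show False using neg by (simp add: ip_cnj)
  qed
  then show pos: "Re (ip v v x) > 0"
    using ip_self_nonneg[of v x] ip_self_of_real[of v x] by (metis less_eq_real_def of_real_0)
  have "r x * (cnj (r x) * ip v v x) = of_real (inverse (sqrt (Re (ip v v x))) ^ 2 * Re (ip v v x))"
    by (subst ip_self_of_real) (simp add: r_def inverse_norm_def power2_eq_square)
  also have "\<dots> = 1" using pos by (simp add: power_inverse)
  finally show "ip (\<lambda>x. inverse_norm v x * v x) (\<lambda>x. inverse_norm v x * v x) x = 1"
    by (simp add: ip_scale_left[OF inv] ip_scale_right[OF inv] flip: r_def)
  have "Re (ip h (\<lambda>x. r x * v x) x) < 0"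
    using neg pos unfolding ip_scale_right[OF inv] by (simp add: r_def inverse_norm_def mult_less_0_iff flip: of_real_inverse)
  then show "ip h (\<lambda>x. inverse_norm v x * v x) x \<noteq> 1" by (auto simp: r_def)
qed

section \<open>Characters restricted to \<open>F\<close>\<close>

lemma torus_char_root_of_unity:
  assumes "w \<in> F" shows "torus_char k w ^ card F = 1"
proof -
  \<comment> \<open>Translation by \<open>w\<close> permutes \<open>F\<close>, so the product over
    \<open>F\<close> is unchanged while each factor gains \<open>torus_char k w\<close>.\<close>
  have "(\<Prod>u\<in>F. torus_char k u) = (\<Prod>u\<in>F. torus_char k (w + u))"
    using assms
    by (intro prod.reindex_bij_witness[where i = "\<lambda>u. w + u" and j = "\<lambda>u. - w + u"])
      (auto simp: algebra_simps intro: add_in_F[OF minus_in_F, of w, simplified] add_in_F)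
  also have "\<dots> = torus_char k w ^ card F * (\<Prod>u\<in>F. torus_char k u)"
    by (simp add: torus_char_add_right prod.distrib)
  finally show ?thesis
    using finite_F by (auto simp: prod_zero_iff)
qed

text \<open>Translation by \<open>v\<close> preserves the sum and also multiplies it by a number
  other than \<open>1\<close>.\<close>

lemma sum_torus_char:
  assumes "v \<in> F" "torus_char k v \<noteq> 1" shows "(\<Sum>w\<in>F. torus_char k w) = 0"
proof -
  have "(\<Sum>w\<in>F. torus_char k w) = torus_char k v * (\<Sum>w\<in>F. torus_char k w)"
    using sum_F_translate[OF assms(1), of "torus_char k"]
    by (simp add: torus_char_add_right sum_distrib_left)
  with assms(2) show ?thesis by simp
qed

text \<open>The orthogonality relations on \<open>F\<close>, summed over \<open>F\<close> and over the restrictions to \<open>F\<close> of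
  the characters, show that there are exactly \<open>card F\<close> such restrictions.\<close>

lemma characters_on_F:
  obtains K :: "(int ^ 'n) set" where "finite K" "card K = card F"
    "\<And>k l. k \<in> K \<Longrightarrow> l \<in> K \<Longrightarrow> k \<noteq> l \<Longrightarrow> \<exists>w\<in>F. torus_char k w \<noteq> torus_char l w"
proof -
  \<comment> \<open>\<open>restrict\<close> makes equality of values of \<open>rho\<close> mean
    agreement on \<open>F\<close>. There are finitely many such values, since characters take roots
    of unity on \<open>F\<close>.\<close>
  define rho where "rho k = restrict (torus_char k) F" for k :: "int ^ 'n"
  have "range rho \<subseteq> PiE F (\<lambda>_. {z. z ^ card F = 1})"
    using torus_char_root_of_unity by (auto simp: rho_def)
  moreover have "finite {z::complex. z ^ card F = 1}"
    using card_F_pos by (intro finite_roots_unity) simp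
  ultimately have fin: "finite (range rho)"
    using finite_PiE[OF finite_F] by (metis (no_types, lifting) finite_subset)
  \<comment> \<open>The dual orthogonality relation: multiplication by a character \<open>l\<close>
    that is nontrivial at \<open>w\<close> permutes \<open>range rho\<close>, with multiplication by
    the character of \<open>- l\<close> as inverse.\<close>
  have zero: "(\<Sum>c\<in>range rho. c w) = 0" if w: "w \<in> F" "w \<noteq> 0" for w
  proof -
    obtain l where l: "torus_char l w \<noteq> 1"
      using torus_char_separates[OF w(2)] by auto
    have mult: "restrict (\<lambda>u. torus_char m u * c u) F \<in> range rho" if c: "c \<in> range rho" for c m
    proof -
      obtain k where "c = rho k" using c by blast
      then have "restrict (\<lambda>u. torus_char m u * c u) F = rho (m + k)"
        by (auto simp: rho_def torus_char_add_left)
      then show ?thesis by blast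
    qed
    have inv: "restrict (\<lambda>u. torus_char (- m) u * restrict (\<lambda>u. torus_char m u * c u) F u) F = c"
      if "c \<in> range rho" for c m
    proof -
      have "torus_char (- m) u * torus_char m u = 1" for u
        by (simp add: torus_char_add_left[symmetric])
      then show ?thesis using that by (auto simp: rho_def simp flip: mult.assoc)
    qed
    have "(\<Sum>c\<in>range rho. c w) = (\<Sum>c\<in>range rho. torus_char l w * c w)"
      using w(1) mult[of _ l] mult[of _ "- l"] inv[of _ l] inv[of _ "- l"]
      by (intro sum.reindex_bij_witness[where i = "\<lambda>c. restrict (\<lambda>u. torus_char l u * c u) F"
            and j = "\<lambda>c. restrict (\<lambda>u. torus_char (- l) u * c u) F"])
        (simp_all flip: mult.assoc torus_char_add_left)
    then have "(\<Sum>c\<in>range rho. c w) = torus_char l w * (\<Sum>c\<in>range rho. c w)"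
      by (subst sum_distrib_left)
    then show ?thesis using l by simp
  qed
  have one: "(\<Sum>w\<in>F. c w) = (if c = rho 0 then of_nat (card F) else 0)" if c: "c \<in> range rho" for c
  proof -
    obtain k where k: "c = rho k" using c by blast
    show ?thesis
    proof (cases "\<exists>v\<in>F. torus_char k v \<noteq> 1")
      case True
      then have "c \<noteq> rho 0" by (auto simp: k rho_def fun_eq_iff restrict_def)
      then show ?thesis using True sum_torus_char[of _ k] by (auto simp: k rho_def)
    next
      case False
      then have "c = rho 0" by (auto simp: k rho_def)
      then show ?thesis by (simp add: rho_def)
    qed
  qed
  \<comment> \<open>Double counting: summing over \<open>F\<close> first leaves only the trivial
    character and gives \<open>card F\<close>; summing over the restrictions first leaves only
    \<open>w = 0\<close>, where each of them is \<open>1\<close>.\<close>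
  have "of_nat (card F) = (\<Sum>c\<in>range rho. \<Sum>w\<in>F. c w)"
    using fin by (simp add: one sum.delta)
  also have "\<dots> = (\<Sum>w\<in>F. \<Sum>c\<in>range rho. c w)"
    by (rule sum.swap)
  also have "\<dots> = (\<Sum>w\<in>F. if w = 0 then \<Sum>c\<in>range rho. c 0 else 0)"
    using zero by (intro sum.cong) auto
  also have "\<dots> = (\<Sum>c\<in>range rho. c 0)"
    using zero_in_F finite_F by (simp add: sum.delta)
  also have "\<dots> = (\<Sum>c\<in>range rho. 1)"
    using zero_in_F by (intro sum.cong) (auto simp: rho_def)
  finally have "of_nat (card F) = (of_nat (card (range rho)) :: complex)" by simp
  then have card: "card (range rho) = card F" by (simp only: of_nat_eq_iff)
  obtain K where K: "inj_on rho K" "range rho = rho ` K"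
    using subset_image_inj[of "range rho" rho UNIV] by auto
  show ?thesis
  proof
    show "finite K" using K fin by (metis finite_imageD)
    show "card K = card F" using K card by (simp add: card_image)
    fix k l assume kl: "k \<in> K" "l \<in> K" "k \<noteq> l"
    then have "rho k \<noteq> rho l" using K(1) by (auto dest: inj_onD)
    then show "\<exists>w\<in>F. torus_char k w \<noteq> torus_char l w"
      by (auto simp: rho_def restrict_def fun_eq_iff split: if_splits)
  qed
qed

text \<open>A character times the conjugate of another is the character of \<open>k - l\<close>,
  which splits off its value at \<open>x\<close>. Orthogonality is thereby reduced to
  \<open>sum_torus_char\<close>.\<close>

lemma ip_torus_char:
  "ip (torus_char k) (torus_char l) x
    = torus_char (k - l) x * (inverse (of_nat (card F)) * (\<Sum>w\<in>F. torus_char (k - l) w))"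
proof -
  have "torus_char k (x - w) * cnj (torus_char l (x - w)) = torus_char (k - l) (x - w)" for w
    using torus_char_add_left[of k "- l" "x - w"] by (simp add: torus_char_minus_left)
  moreover have "torus_char m (x - w) = torus_char m x * torus_char m (- w)" for m w
    using torus_char_add_right[of m x "- w"] by simp
  moreover have "(\<Sum>w\<in>F. torus_char (k - l) (- w)) = (\<Sum>w\<in>F. torus_char (k - l) w)"
    by (rule sum.reindex_bij_witness[where i = uminus and j = uminus]) (simp_all add: minus_in_F)
  ultimately show ?thesis
    by (simp add: ip_A_def sum_distrib_left[symmetric])
qed

lemma character_frame:
  obtains k where "orthonormal_frame (\<lambda>j. torus_char (k j))"
proof -
  obtain K where K: "finite K" "card K = card F"
    "\<And>k l. k \<in> K \<Longrightarrow> l \<in> K \<Longrightarrow> k \<noteq> l \<Longrightarrow> \<exists>w\<in>F. torus_char k w \<noteq> torus_char l w"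
    using characters_on_F by metis
  obtain k where k: "bij_betw k {0..<card F} K"
    using ex_bij_betw_nat_finite[OF K(1)] K(2) by auto
  have "ip (torus_char (k i)) (torus_char (k j)) x = (if i = j then 1 else 0)"
    if ij: "i < card F" "j < card F" for i j x
  proof (cases "i = j")
    case True
    then show ?thesis using card_F_pos by (simp add: ip_torus_char)
  next
    case False
    then have "k i \<in> K" "k j \<in> K" "k i \<noteq> k j"
      using k ij by (auto simp: bij_betw_def inj_on_def)
    from K(3)[OF this] obtain w where w: "w \<in> F" "torus_char (k i) w \<noteq> torus_char (k j) w" by blast
    have "torus_char (k i) w = torus_char (k i - k j) w * torus_char (k j) w"
      by (simp flip: torus_char_add_left)
    with w have "torus_char (k i - k j) w \<noteq> 1" by auto
    with False sum_torus_char[OF w(1)] show ?thesis by (simp add: ip_torus_char)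
  qed
  then have "orthonormal_frame (\<lambda>j. torus_char (k j))"
    by (auto simp: orthonormal_frame_def intro: torus_smooth_imp_torus_C torus_smooth_char)
  then show ?thesis by (rule that)
qed

section \<open>Smooth frames and frames with a prescribed first vector\<close>

lemma frame_from_reflection:
  assumes g: "orthonormal_frame g" and h: "h \<in> torus_C" "\<And>x. ip h h x = 1"
    and ne: "\<And>x. ip (g 0) h x \<noteq> 1"
  obtains g' where "orthonormal_frame g'" "g' 0 = h"
  by (rule orthonormal_frame_reflect[OF g card_F_pos h ne]) (rule that)

text \<open>A smooth approximation of \<open>- g j\<close> is projected to the orthogonal complement of
  \<open>g 0, \<dots>, g (j - 1)\<close> and normalized, and \<open>g j\<close> is reflected to the result. The sign keeps the two
  vectors apart, as the reflection requires.\<close>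

lemma smooth_frame_step:
  assumes g: "orthonormal_frame g" and j: "j < card F" and smooth: "\<And>i. i < j \<Longrightarrow> torus_smooth (g i)"
  obtains g' where "orthonormal_frame g'" "\<And>i. i < j \<Longrightarrow> g' i = g i" "torus_smooth (g' j)"
proof -
  have gC: "g i \<in> torus_C" if "i < card F" for i using g that by (simp add: orthonormal_frame_def)
  have gg: "ip (g i) (g k) x = (if i = k then 1 else 0)" if "i < card F" "k < card F" for i k x
    using g that by (simp add: orthonormal_frame_def)
  have "(\<lambda>x. - g j x) \<in> torus_C" using gC[OF j] by (auto simp: torus_C_def intro: continuous_intros)
  then obtain s where s: "torus_smooth s" "\<And>x. cmod (s x - - g j x) < 1"
    using smooth_approximation zero_less_one by blast
  \<comment> \<open>\<open>y\<close> is the approximation error, \<open>P\<close> the orthogonal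
    projection onto the span of \<open>g 0, ..., g (j - 1)\<close>.\<close>
  define y where "y = (\<lambda>x. s x + g j x)"
  define P where "P f = (\<lambda>x. \<Sum>i<j. ip f (g i) x * g i x)" for f
  define v where "v = (\<lambda>x. s x - P s x)"
  have v_smooth: "torus_smooth v"
    unfolding v_def P_def
    by (intro torus_smooth_diff[OF s(1)] torus_smooth_sum torus_smooth_mult torus_smooth_ip_A s(1) smooth) auto
  have P_left: "ip (P f) h x = (\<Sum>i<j. ip f (g i) x * ip (g i) h x)" for f h x
    by (simp add: P_def ip_sum_left ip_scale_left[OF invariant_ip])
  have P_g: "ip (P f) (g i) x = ip f (g i) x" if "i < j" for f i x
  proof -
    have "ip (P f) (g i) x = (\<Sum>k<j. if k = i then ip f (g k) x else 0)"
      unfolding P_left using that j by (intro sum.cong) (auto simp: gg)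
    then show ?thesis using that by (simp add: sum.delta)
  qed
  have v_orth: "ip v (g i) x = 0" if "i < j" for i x
    using P_g[OF that, of s x] by (simp add: v_def ip_diff_left)
  \<comment> \<open>\<open>g j\<close> is orthogonal to the earlier vectors, so \<open>P y\<close>
    equals \<open>P s\<close>, and \<open>v + g j\<close> is the error minus its projection.\<close>
  have v_y: "v x + g j x = y x - P y x" for x
  proof -
    have "ip y (g i) x = ip s (g i) x" if "i < j" for i
      using gg[OF j, of i x] that j by (simp add: y_def ip_add_left)
    then have "P y x = P s x" by (simp add: P_def)
    then show ?thesis by (simp add: v_def y_def)
  qed
  have near: "Re (ip (\<lambda>x. v x + g j x) (\<lambda>x. v x + g j x) x) < 1" for x
  proof -
    \<comment> \<open>Pythagoras: subtracting the projection cannot enlarge the norm, and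
      \<open>y\<close> has norm below \<open>1\<close>. Both mixed terms equal
      \<open>ip (P y) (P y) x\<close>.\<close>
    have PP: "ip (P y) (P y) x = ip (P y) y x"
    proof -
      have "ip (P y) (P y) x = (\<Sum>i<j. ip y (g i) x * ip (g i) (P y) x)" by (rule P_left)
      also have "\<dots> = (\<Sum>i<j. ip y (g i) x * ip (g i) y x)"
        using P_g[of _ y x] by (intro sum.cong) (simp_all flip: ip_cnj[of _ "g _"])
      finally show ?thesis by (simp add: P_left)
    qed
    have "ip y (P y) x = cnj (ip (P y) (P y) x)"
      by (simp only: PP ip_cnj)
    then have "ip y (P y) x = ip (P y) y x"
      by (simp only: ip_cnj) (simp only: PP)
    then have "ip (\<lambda>x. y x - P y x) (\<lambda>x. y x - P y x) x = ip y y x - ip (P y) (P y) x"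
      using PP by (simp add: ip_diff_left ip_diff_right)
    then have "Re (ip (\<lambda>x. y x - P y x) (\<lambda>x. y x - P y x) x) \<le> Re (ip y y x)"
      using ip_self_nonneg[of "P y" x] by simp
    also have "\<dots> < 1"
      using s(2) by (intro ip_self_less_1) (simp add: y_def)
    finally show ?thesis by (simp only: v_y)
  qed
  have "ip (g j) (g j) x = 1" for x using gg[OF j j] by simp
  note n = normalize_near_minus[of "g j" v, OF this near]
  define u where "u = (\<lambda>x. inverse_norm v x * v x)"
  have u_smooth: "torus_smooth u"
    unfolding u_def inverse_norm_def
    using n(1) by (intro torus_smooth_mult torus_smooth_inverse_sqrt torus_smooth_ip_A v_smooth)
  have u_orth: "ip (g i) u x = 0" if "i < j" for i x
    using v_orth[OF that, of x] by (simp add: u_def ip_scale_right[OF invariant_inverse_norm] flip: ip_cnj[of v])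
  obtain g' where g': "orthonormal_frame g'" "g' j = u"
    "\<And>i. i < card F \<Longrightarrow> i \<noteq> j \<Longrightarrow> (\<And>x. ip (g i) u x = 0) \<Longrightarrow> g' i = g i"
    using orthonormal_frame_reflect[OF g j torus_smooth_imp_torus_C[OF u_smooth] n(2)[folded u_def] n(3)[folded u_def]]
    by blast
  show ?thesis
  proof
    show "orthonormal_frame g'" by (rule g')
    show "g' i = g i" if "i < j" for i using g'(3)[of i] u_orth[OF that] that j by simp
    show "torus_smooth (g' j)" using u_smooth g' by simp
  qed
qed

text \<open>Each step of the induction makes one more vector smooth and leaves the earlier ones, in
  particular \<open>g 0\<close>, in place.\<close>

lemma smooth_frame:
  assumes g: "orthonormal_frame g" and smooth: "torus_smooth (g 0)"
  obtains g' where "orthonormal_frame g'" "g' 0 = g 0" "\<And>i. i < card F \<Longrightarrow> torus_smooth (g' i)"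
proof -
  have "\<exists>g'. orthonormal_frame g' \<and> g' 0 = g 0 \<and> (\<forall>i<Suc j. torus_smooth (g' i))" if "j < card F" for j
    using that
  proof (induction j)
    case 0
    then show ?case using g smooth by auto
  next
    case (Suc j)
    then obtain f where f: "orthonormal_frame f" "f 0 = g 0" "\<And>i. i < Suc j \<Longrightarrow> torus_smooth (f i)"
      by auto
    obtain f' where f': "orthonormal_frame f'" "\<And>i. i < Suc j \<Longrightarrow> f' i = f i" "torus_smooth (f' (Suc j))"
      using smooth_frame_step[OF f(1) Suc.prems f(3)] by blast
    have "f' 0 = g 0" using f'(2)[of 0] f(2) by simp
    moreover have "\<forall>i<Suc (Suc j). torus_smooth (f' i)"
      using f(3) f' by (metis less_SucE)
    ultimately show ?case using f'(1) by blast
  qed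
  from this[of "card F - 1"] show ?thesis using card_F_pos that by auto
qed

text \<open>Reflecting \<open>e 0\<close> straight to \<open>m\<close> may fail where the two agree.
  The detour needs \<open>p\<close> to avoid the smooth \<open>u\<close>, which is where the
  dimension enters, and \<open>u\<close> to avoid \<open>m\<close>, which holds because
  \<open>u\<close> lies near \<open>- m\<close>.\<close>

lemma frame_of_small_dimension:
  assumes m: "m \<in> torus_C" "\<And>x. ip m m x = 1" and dim: "CARD('n) < 2 * card F - 1"
  obtains g where "orthonormal_frame g" "g 0 = m"
proof -
  have "(\<lambda>x. - m x) \<in> torus_C" using m by (auto simp: torus_C_def intro: continuous_intros)
  then obtain s where s: "torus_smooth s" "\<And>x. cmod (s x - - m x) < 1"
    using smooth_approximation zero_less_one by blast
  have near: "Re (ip (\<lambda>x. s x + m x) (\<lambda>x. s x + m x) x) < 1" for x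
    using s(2) by (intro ip_self_less_1) simp
  note n = normalize_near_minus[of m s, OF m(2) near]
  define u where "u = (\<lambda>x. inverse_norm s x * s x)"
  have u: "u \<in> torus_C"
    unfolding u_def inverse_norm_def using n(1)
    by (intro torus_smooth_imp_torus_C torus_smooth_mult torus_smooth_inverse_sqrt torus_smooth_ip_A s)
  obtain k where "orthonormal_frame (\<lambda>j. torus_char (k j))" by (rule character_frame)
  then obtain e where e: "orthonormal_frame e" "\<And>j. torus_smooth (e j)"
    using torus_smooth_char by blast
  have ee: "ip (e i) (e j) x = (if i = j then 1 else 0)" if "i < card F" "j < card F" for i j x
    using e that by (simp add: orthonormal_frame_def)
  \<comment> \<open>The coordinates of \<open>u\<close> are positive multiples of those of
    \<open>s\<close>, so excluding all real multiples of the latter keeps the direction of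
    \<open>v\<close> away from \<open>u\<close>.\<close>
  obtain v where v: "\<And>t x. \<exists>j<card F. v j \<noteq> of_real t * ip s (e j) x"
  proof (rule smooth_lines_miss_vector[of "card F" "\<lambda>j. ip s (e j)"])
    show "CARD('n) + 2 \<le> 2 * card F" using dim by linarith
  qed (auto intro: torus_smooth_ip_A s e)
  define N where "N = sqrt (\<Sum>j<card F. (cmod (v j))\<^sup>2)"
  \<comment> \<open>The multiple \<open>t = 0\<close> shows that some \<open>v j\<close> with
    \<open>j < card F\<close> is nonzero; the constants \<open>v j / N\<close> are then the
    coordinates of a unit vector \<open>p\<close>.\<close>
  have "N \<noteq> 0"
    using v[of 0] by (auto simp: N_def sum_nonneg_eq_0_iff)
  define p where "p = (\<lambda>x. \<Sum>j<card F. v j / of_real N * e j x)"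
  have p_e: "ip p (e i) x = v i / of_real N" if "i < card F" for i x
  proof -
    have "ip p (e i) x = (\<Sum>j<card F. v j / of_real N * ip (e j) (e i) x)"
      unfolding p_def by (subst ip_sum_left, subst ip_scale_left[OF invariant_const]) (rule refl)
    also have "\<dots> = (\<Sum>j<card F. if j = i then v j / of_real N else 0)"
      using that by (intro sum.cong) (simp_all add: ee)
    finally show ?thesis using that by (simp add: sum.delta)
  qed
  have p_unit: "ip p p x = 1" for x
  proof -
    have "ip p p x = (\<Sum>j<card F. v j / of_real N * ip (e j) p x)"
      unfolding p_def by (subst ip_sum_left, subst ip_scale_left[OF invariant_const]) (rule refl)
    also have "\<dots> = (\<Sum>j<card F. of_real ((cmod (v j))\<^sup>2 / N\<^sup>2))"
    proof (rule sum.cong)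
      fix j assume "j \<in> {..<card F}"
      then have "ip (e j) p x = cnj (v j / of_real N)"
        using p_e[of j x] ip_cnj[of p "e j" x] by simp
      then show "v j / of_real N * ip (e j) p x = of_real ((cmod (v j))\<^sup>2 / N\<^sup>2)"
        by (simp only: complex_norm_square[symmetric]) (simp add: norm_divide power_divide)
    qed simp
    also have "\<dots> = of_real ((\<Sum>j<card F. (cmod (v j))\<^sup>2) / N\<^sup>2)"
      by (simp add: sum_divide_distrib)
    also have "(\<Sum>j<card F. (cmod (v j))\<^sup>2) = N\<^sup>2"
      by (simp add: N_def sum_nonneg)
    finally show ?thesis using \<open>N \<noteq> 0\<close> by simp
  qed
  have p: "p \<in> torus_C"
    unfolding p_def
    by (intro torus_smooth_imp_torus_C torus_smooth_sum torus_smooth_mult[OF torus_smooth_const e(2)])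
  have p_ne_u: "ip p u x \<noteq> 1" for x
  proof
    assume "ip p u x = 1"
    moreover have "ip u u x = 1" using n(2) by (simp add: u_def)
    ultimately have "p (x - w) = u (x - w)" if "w \<in> F" for w
      using ip_eq_1_imp_eq[OF p_unit] that by blast
    then have "ip p (e j) x = ip u (e j) x" for j
      by (simp add: ip_A_def)
    then have "v j / of_real N = inverse_norm s x * ip s (e j) x" if "j < card F" for j
      using p_e[OF that, of x] by (simp add: u_def ip_scale_left[OF invariant_inverse_norm])
    then have "v j = of_real (N * inverse (sqrt (Re (ip s s x)))) * ip s (e j) x" if "j < card F" for j
      using that \<open>N \<noteq> 0\<close> by (simp add: inverse_norm_def field_simps)
    then show False using v by blast
  qed
  \<comment> \<open>\<open>p\<close> has constant coordinates, so \<open>ip (e 0) p\<close> is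
    constant. If it is \<open>1\<close> at one point, then \<open>e 0 = p\<close> and the frame
    \<open>e\<close> already serves; otherwise the reflection applies.\<close>
  obtain f where f: "orthonormal_frame f" "f 0 = p"
  proof (cases "\<exists>x. ip (e 0) p x = 1")
    case False
    then show thesis using frame_from_reflection[OF e(1) p p_unit] that by blast
  next
    case True
    moreover have "ip (e 0) p x = cnj (v 0 / of_real N)" for x
      using p_e[OF card_F_pos, of x] ip_cnj[of p "e 0" x] by simp
    ultimately have e_p: "ip (e 0) p x = 1" for x by simp
    have "ip (e 0) (e 0) x = 1" for x
      using ee[OF card_F_pos card_F_pos] by simp
    then have "e 0 (x - 0) = p (x - 0)" for x
      by (rule ip_eq_1_imp_eq[OF _ p_unit e_p zero_in_F])
    then have "e 0 = p" by (simp add: fun_eq_iff)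
    with e(1) show thesis by (rule that)
  qed
  have "ip (f 0) u x \<noteq> 1" for x
    using p_ne_u f(2) by simp
  then obtain f' where f': "orthonormal_frame f'" "f' 0 = u"
    by (rule frame_from_reflection[OF f(1) u n(2)[folded u_def]])
  have "ip u m x \<noteq> 1" for x
  proof
    assume "ip u m x = 1"
    then have "ip m u x = 1" using ip_cnj[of u m x] by simp
    with n(3)[of x] show False by (simp only: u_def)
  qed
  then have "ip (f' 0) m x \<noteq> 1" for x
    by (simp only: f'(2) not_False_eq_True)
  then show ?thesis
    by (rule frame_from_reflection[OF f'(1) m]) (rule that)
qed

text \<open>In two complex dimensions the pair \<open>(a, b)\<close> is orthogonal to
  \<open>(cnj b, - cnj a)\<close>. The values at \<open>x\<close> and \<open>x - w\<close> play the
  role of \<open>a\<close> and \<open>b\<close>; the sign comes from a character with value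
  \<open>- 1\<close> at \<open>w\<close>.\<close>

lemma frame_of_card_2:
  assumes m: "m \<in> torus_C" "\<And>x. ip m m x = 1" and two: "card F = 2"
  obtains g where "orthonormal_frame g" "g 0 = m"
proof -
  obtain w where w: "w \<noteq> 0" "F = {0, w}"
    using two zero_in_F by (auto simp: card_2_iff)
  have "w + w \<in> F" by (intro add_in_F) (simp_all add: w)
  then have ww: "w + w = 0" using w by auto
  then have xww: "x - w - w = x" for x by (simp add: diff_diff_eq)
  obtain k where k: "torus_char k w \<noteq> 1"
    using torus_char_separates[OF w(1)] by auto
  have "torus_char k w * torus_char k w = 1"
    using ww by (simp flip: torus_char_add_right)
  with k have kw: "torus_char k w = - 1"
    by (simp add: square_eq_1_iff)
  have "torus_char k x = torus_char k (x - w) * torus_char k w" for x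
    by (simp flip: torus_char_add_right)
  from this kw have shift: "torus_char k (x - w) = - torus_char k x" for x
    by (metis minus_equation_iff mult_minus1_right)
  have unit: "cnj (torus_char k x) * torus_char k x = 1" for x
    by (simp flip: torus_char_minus_left torus_char_add_left)
  have ip2: "ip f g x = (f x * cnj (g x) + f (x - w) * cnj (g (x - w))) / 2" for f g x
    using w by (simp add: ip_A_def field_simps)
  define g where "g = (\<lambda>x. torus_char k x * cnj (m (x - w)))"
  have "continuous_on UNIV (\<lambda>x. m (x - w))"
    using m(1) continuous_on_compose2[of UNIV m UNIV "\<lambda>x. x - w"] continuous_on_torus_diff
    by (auto simp: torus_C_def)
  moreover have "torus_char k \<in> torus_C"
    by (rule torus_smooth_imp_torus_C[OF torus_smooth_char])
  ultimately have gC: "g \<in> torus_C"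
    by (auto simp: g_def torus_C_def intro!: continuous_intros)
  have mg: "ip m g x = 0" for x
    by (simp add: ip2 g_def xww shift)
  then have gm: "ip g m x = 0" for x
    using ip_cnj[of m g x] by simp
  have "g y * cnj (g y) = m (y - w) * cnj (m (y - w))" for y
  proof -
    have "g y * cnj (g y) = (cnj (torus_char k y) * torus_char k y) * (m (y - w) * cnj (m (y - w)))"
      by (simp add: g_def)
    then show ?thesis by (simp only: unit) simp
  qed
  then have gg: "ip g g x = 1" for x
    using m(2)[of x] by (simp add: ip2 xww add.commute)
  have "orthonormal_frame (\<lambda>i. if i = 0 then m else g)"
    unfolding orthonormal_frame_def two using m gC mg gm gg by (auto simp: less_2_cases_iff)
  then show ?thesis by (rule that) simp
qed

section \<open>Translation between filter families and frames\<close>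

lemma high_pass_family_iff_frame:
  assumes m0: "m0 \<in> torus_C"
  shows "high_pass_family F m0 m \<longleftrightarrow>
    orthonormal_frame (\<lambda>j x. of_real (inverse (sqrt (card F))) * (m(0 := m0)) j x)"
proof -
  \<comment> \<open>Filters have inner square \<open>card F\<close>, frame vectors \<open>1\<close>.
    The scaling by \<open>c\<close> is invertible; one direction of the equivalence produces
    families, the other starts the smoothing of a given family.\<close>
  define c where "c = complex_of_real (inverse (sqrt (card F)))"
  let ?m = "m(0 := m0)"
  have "inverse (sqrt (card F)) * inverse (sqrt (card F)) * card F = 1"
    using card_F_pos by (simp flip: inverse_mult_distrib)
  then have "complex_of_real (inverse (sqrt (card F)) * inverse (sqrt (card F)) * card F) = 1"
    by (simp only: of_real_1)
  then have c: "c * cnj c * of_nat (card F) = 1"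
    by (simp only: c_def of_real_mult of_real_of_nat_eq complex_cnj_complex_of_real)
  then have c_nz: "c \<noteq> 0" by auto
  have "f \<in> torus_C \<longleftrightarrow> (\<lambda>x. c * f x) \<in> torus_C" for f :: "'n torus \<Rightarrow> complex"
  proof
    assume "(\<lambda>x. c * f x) \<in> torus_C"
    then have "continuous_on UNIV (\<lambda>x. inverse c * (c * f x))"
      unfolding torus_C_def mem_Collect_eq by (rule continuous_on_mult_left)
    moreover have "(\<lambda>x. inverse c * (c * f x)) = f"
      using c_nz by (simp add: fun_eq_iff)
    ultimately show "f \<in> torus_C" by (simp only: torus_C_def mem_Collect_eq)
  qed (auto simp: torus_C_def intro: continuous_on_mult_left)
  \<comment> \<open>Slot \<open>0\<close> is absent on the left; on the right it holds a multiple of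
    \<open>m0\<close>, which is continuous by hypothesis.\<close>
  then have 1: "(\<forall>j\<in>{1..<card F}. m j \<in> torus_C) \<longleftrightarrow> (\<forall>j<card F. (\<lambda>x. c * ?m j x) \<in> torus_C)"
    using m0 by (auto simp: Suc_le_eq)
  have "ip (\<lambda>x. c * f x) (\<lambda>x. c * g x) x = c * cnj c * ip f g x" for f g x
    unfolding ip_scale_left[OF invariant_const] ip_scale_right[OF invariant_const] by (rule mult.assoc[symmetric])
  moreover have "c * cnj c * a = (if P then 1 else 0) \<longleftrightarrow> a = (if P then of_nat (card F) else 0)" for a P
  proof (cases P)
    case True
    have "c * cnj c * a = 1 \<longleftrightarrow> c * cnj c * a = c * cnj c * of_nat (card F)" using c by simp
    then show ?thesis using True c_nz by simp
  qed (use c_nz in simp)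
  ultimately have 2: "ip (\<lambda>x. c * f x) (\<lambda>x. c * g x) x = (if P then 1 else 0)
      \<longleftrightarrow> ip f g x = (if P then of_nat (card F) else 0)" for f g x P
    by simp
  show ?thesis
    unfolding c_def[symmetric] high_pass_family_def orthonormal_frame_def 1 2
    by (simp only: fun_eq_iff Ball_def atLeastLessThan_iff le0 simp_thms)
qed

lemma high_pass_family_of_frame:
  assumes m0: "m0 \<in> torus_C" and g: "orthonormal_frame g"
    and g0: "g 0 = (\<lambda>x. of_real (inverse (sqrt (card F))) * m0 x)"
  shows "high_pass_family F m0 (\<lambda>j x. of_real (sqrt (card F)) * g j x)"
proof -
  have "complex_of_real (inverse (sqrt (card F))) * of_real (sqrt (card F)) = 1"
    using card_F_pos by simp
  then have "(\<lambda>j x. of_real (inverse (sqrt (card F))) * ((\<lambda>j x. of_real (sqrt (card F)) * g j x)(0 := m0)) j x) = g"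
    by (auto simp: fun_eq_iff g0 simp flip: mult.assoc)
  then show ?thesis using g high_pass_family_iff_frame[OF m0] by simp
qed

lemma low_pass_filter_unit:
  assumes "low_pass_filter F m0"
  defines "m \<equiv> \<lambda>x. of_real (inverse (sqrt (card F))) * m0 x"
  shows "m0 \<in> torus_C" "m \<in> torus_C" "ip m m x = 1"
proof -
  show m0: "m0 \<in> torus_C" using assms(1) by (simp add: low_pass_filter_def)
  then show "m \<in> torus_C"
    by (auto simp: m_def torus_C_def intro: continuous_on_mult_left)
  have "ip m m x = of_real (inverse (sqrt (card F)) * inverse (sqrt (card F)) * card F)"
    using assms(1) unfolding m_def ip_scale_left[OF invariant_const] ip_scale_right[OF invariant_const]
    by (simp add: low_pass_filter_def)
  also have "inverse (sqrt (card F)) * inverse (sqrt (card F)) * card F = 1"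
    using card_F_pos by (simp flip: inverse_mult_distrib)
  finally show "ip m m x = 1" by simp
qed

end

theorem theorem3p1:
  fixes F :: "('n::finite) torus set" and q :: nat
  assumes "finite F" and "torus_subgroup F" and "card F = q"
  shows "(\<forall>m0. low_pass_filter F m0 \<and> (q = 2 \<or> CARD('n) < 2 * q - 1)
             \<longrightarrow> (\<exists>m. high_pass_family F m0 m)) \<and>
         (CARD('n) \<le> 4 \<longrightarrow>
           (\<forall>m0. low_pass_filter F m0 \<longrightarrow> (\<exists>m. high_pass_family F m0 m))) \<and>
         (\<forall>m0. low_pass_filter F m0 \<and> (\<exists>m. high_pass_family F m0 m) \<and> torus_smooth m0
             \<longrightarrow> (\<exists>m'. high_pass_family F m0 m' \<and> (\<forall>j\<in>{1..<q}. torus_smooth (m' j))))"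
proof -
  interpret finite_torus_subgroup F by standard (fact assms)+
  let ?m = "\<lambda>m0 x. complex_of_real (inverse (sqrt (card F))) * m0 x"
  have part1: "\<exists>m. high_pass_family F m0 m"
    if m0: "low_pass_filter F m0" and q: "q = 2 \<or> CARD('n) < 2 * q - 1" for m0
  proof -
    note m = low_pass_filter_unit[OF m0]
    obtain g where "orthonormal_frame g" "g 0 = ?m m0"
      using q assms(3) frame_of_card_2[OF m(2,3)] frame_of_small_dimension[OF m(2,3)] by blast
    from high_pass_family_of_frame[OF m(1) this] show ?thesis by blast
  qed
  have "\<exists>m. high_pass_family F m0 m" if m0: "low_pass_filter F m0" and n: "CARD('n) \<le> 4" for m0
  proof (cases "q = 1")
    case True
    \<comment> \<open>For \<open>q = 1\<close> the bound \<open>CARD('n) < 2 * q - 1\<close> fails,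
      but there are no slots to fill and the only relation is that of \<open>m0\<close> with
      itself.\<close>
    then have "high_pass_family F m0 (\<lambda>_. m0)"
      using m0 assms(3) by (simp add: high_pass_family_def low_pass_filter_def)
    then show ?thesis by blast
  next
    case False
    \<comment> \<open>\<open>q\<close> is positive since \<open>0 \<in> F\<close>, and
      \<open>q \<ge> 3\<close> gives \<open>2 * q - 1 \<ge> 5\<close>.\<close>
    then have "q = 2 \<or> CARD('n) < 2 * q - 1"
      using n card_F_pos assms(3) by linarith
    then show ?thesis by (rule part1[OF m0])
  qed
  moreover have "\<exists>m'. high_pass_family F m0 m' \<and> (\<forall>j\<in>{1..<q}. torus_smooth (m' j))"
    if m0: "low_pass_filter F m0" and m: "high_pass_family F m0 m" and smooth: "torus_smooth m0" for m0 m
  proof -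
    have C: "m0 \<in> torus_C" by (rule low_pass_filter_unit(1)[OF m0])
    let ?g = "\<lambda>j x. complex_of_real (inverse (sqrt (card F))) * (m(0 := m0)) j x"
    have frame: "orthonormal_frame ?g"
      using m high_pass_family_iff_frame[OF C] by blast
    have "torus_smooth (?g 0)"
      by (simp only: fun_upd_same) (rule torus_smooth_mult[OF torus_smooth_const smooth])
    then obtain g where g: "orthonormal_frame g" "g 0 = ?g 0" "\<And>i. i < card F \<Longrightarrow> torus_smooth (g i)"
      using smooth_frame[OF frame] by blast
    have "high_pass_family F m0 (\<lambda>j x. of_real (sqrt (card F)) * g j x)"
      using high_pass_family_of_frame[OF C g(1)] g(2) by simp
    moreover have "torus_smooth (\<lambda>x. of_real (sqrt (card F)) * g j x)" if "j < card F" for j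
      by (rule torus_smooth_mult[OF torus_smooth_const g(3)[OF that]])
    ultimately show ?thesis using assms(3) by auto
  qed
  ultimately show ?thesis using part1 by blast
qed

end
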